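(* For all $m\ge 3$, the Sperner systems $\mathcal{U}^{2m+2}_1$ and $\mathcal{U}^{2m+2}_2$ are strongly hypomorphic.
   Context: A set system over a finite set $A$ (the ground set) is a set of subsets of $A$, called blocks; it is a Sperner system if no block is included in another. Set systems $\mathcal A$ over $A$ and $\mathcal B$ over $B$ are isomorphic, $\mathcal A\equiv\mathcal B$, if there is a bijection $\sigma\colon A\to B$ with $\{\sigma(S):S\in\mathcal A\}=\mathcal B$. For a two-element subset $I$ of $A$, let $\theta_I$ be the equivalence relation on $A$ whose only nonsingleton class is $I$; for $S\subseteq A$ let $S_I=\{x/\theta_I:x\in S\}\subseteq A/\theta_I$; for a Sperner system $\mathcal A$ over $A$ let $\mathcal A_I=\{S_I:S\in\mathcal A\}$ and let $\mathcal A^*_I$ be the set of inclusion-minimal elements of $\mathcal A_I$, a Sperner system over $A/\theta_I$. Two Sperner systems $\mathcal A,\mathcal B$ over the same ground set $A$ are strongly hypomorphic if $\mathcal A^*_I\equiv\mathcal B^*_I$ for every two-element subset $I$ of $A$. Let $[m]=\{1,\dots,m\}$. For each $n\in[m]$ let $n'$ be a new element (a primed copy of $n$), and $S'=\{n':n\in S\}$ for $S\subseteq[m]$. Let $E_m=[m]\cup[m]'$, a set with $2m$ elements. Addition of elements of $[m]$ is modulo $m$ with result taken in $[m]$. For $J\subseteq[m]$ let $F^m_J=J\cup([m]\setminus J)'$. Put $\mathcal F^m_1=\{F^m_J: J\subseteq[m],\ |J|\text{ odd}\}$ and $\mathcal F^m_2=\{F^m_J: J\subseteq[m],\ |J|\text{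 even}\}$. For $p\in[m]$ let $G^m_p=E_m\setminus\{p,p',(p+1)'\}$ and $\mathcal G^m=\{G^m_p:p\in[m]\}$. For $i\in\{1,2\}$, $\mathcal M^m_i=\mathcal F^m_i\cup\mathcal G^m$, a Sperner system over $E_m$. Let $0,0'$ be two further distinct elements not in $E_m$. For $m\ge3$ and $i\in\{1,2\}$, $\mathcal U^{2m+2}_i=\{S\cup\{0\}:S\in\mathcal M^m_i\}\cup\{\{0,0'\}\}$, a Sperner system over $E_m\cup\{0,0'\}$. *)

theory Defs
  imports Main
begin

section \<open>Set systems and strong hypomorphism\<close>

definition set_system :: "'a set \<Rightarrow> 'a set set \<Rightarrow> bool" where
  "set_system A \<A> \<longleftrightarrow> finite A \<and> \<A> \<subseteq> Pow A"

definition sperner_system :: "'a set \<Rightarrow> 'a set set \<Rightarrow> bool" where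
  "sperner_system A \<A> \<longleftrightarrow> set_system A \<A> \<and> (\<forall>S\<in>\<A>. \<forall>T\<in>\<A>. S \<subseteq> T \<longrightarrow> S = T)"

definition set_system_iso :: "'a set \<Rightarrow> 'a set set \<Rightarrow> 'b set \<Rightarrow> 'b set set \<Rightarrow> bool" where
  "set_system_iso A \<A> B \<B> \<longleftrightarrow> (\<exists>\<sigma>. bij_betw \<sigma> A B \<and> {\<sigma> ` S |S. S \<in> \<A>} = \<B>)"

definition theta :: "'a set \<Rightarrow> 'a set \<Rightarrow> ('a \<times> 'a) set" where
  "theta A I = {(x, y). x \<in> A \<and> y \<in> A \<and> (x = y \<or> (x \<in> I \<and> y \<in> I))}"

text \<open>\<open>S // theta A I\<close> is the set of the \<open>theta A I\<close>-classes of the elements of \<open>S\<close>,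
  also when \<open>S\<close> is a proper subset of \<open>A\<close>.\<close>

definition contraction :: "'a set \<Rightarrow> 'a set set \<Rightarrow> 'a set \<Rightarrow> 'a set set set" where
  "contraction A \<A> I = {S // theta A I |S. S \<in> \<A>}"

definition minimal_contraction :: "'a set \<Rightarrow> 'a set set \<Rightarrow> 'a set \<Rightarrow> 'a set set set" where
  "minimal_contraction A \<A> I =
     {T \<in> contraction A \<A> I. \<not> (\<exists>T'\<in>contraction A \<A> I. T' \<subset> T)}"

definition strongly_hypomorphic :: "'a set \<Rightarrow> 'a set set \<Rightarrow> 'a set set \<Rightarrow> bool" where
  "strongly_hypomorphic A \<A> \<B> \<longleftrightarrow>
     sperner_system A \<A> \<and> sperner_system A \<B> \<and>
     (\<forall>I. I \<subseteq> A \<and> card I = 2 \<longrightarrow>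
        set_system_iso (A // theta A I) (minimal_contraction A \<A> I)
                       (A // theta A I) (minimal_contraction A \<B> I))"

section \<open>The systems \<open>\<M>\<close> and \<open>\<U>\<close>\<close>

text \<open>\<open>Plain n\<close> is the element \<open>n\<close> and \<open>Primed n\<close> its copy \<open>n'\<close>; the two further elements
  \<open>0\<close> and \<open>0'\<close> are \<open>Plain 0\<close> and \<open>Primed 0\<close>.\<close>

datatype elt = Plain nat | Primed nat

definition E_set :: "nat \<Rightarrow> elt set" where
  "E_set m = Plain ` {1..m} \<union> Primed ` {1..m}"

text \<open>Addition modulo \<open>m\<close> with representatives \<open>1, \<dots>, m\<close>.\<close>

definition add_mod :: "nat \<Rightarrow> nat \<Rightarrow> nat \<Rightarrow> nat" where
  "add_mod m a b = (a + b - 1) mod m + 1"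

definition F_block :: "nat \<Rightarrow> nat set \<Rightarrow> elt set" where
  "F_block m J = Plain ` J \<union> Primed ` ({1..m} - J)"

definition F1_system :: "nat \<Rightarrow> elt set set" where
  "F1_system m = {F_block m J |J. J \<subseteq> {1..m} \<and> odd (card J)}"

definition F2_system :: "nat \<Rightarrow> elt set set" where
  "F2_system m = {F_block m J |J. J \<subseteq> {1..m} \<and> even (card J)}"

definition G_block :: "nat \<Rightarrow> nat \<Rightarrow> elt set" where
  "G_block m p = E_set m - {Plain p, Primed p, Primed (add_mod m p 1)}"

definition G_system :: "nat \<Rightarrow> elt set set" where
  "G_system m = {G_block m p |p. p \<in> {1..m}}"

definition M1_system :: "nat \<Rightarrow> elt set set" where
  "M1_system m = F1_system m \<union> G_system m"

definition M2_system :: "nat \<Rightarrow> elt set set" where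
  "M2_system m = F2_system m \<union> G_system m"

definition U_ground :: "nat \<Rightarrow> elt set" where
  "U_ground m = E_set m \<union> {Plain 0, Primed 0}"

definition U1_system :: "nat \<Rightarrow> elt set set" where
  "U1_system m = {S \<union> {Plain 0} |S. S \<in> M1_system m} \<union> {{Plain 0, Primed 0}}"

definition U2_system :: "nat \<Rightarrow> elt set set" where
  "U2_system m = {S \<union> {Plain 0} |S. S \<in> M2_system m} \<union> {{Plain 0, Primed 0}}"

end

theory Submission
  imports Defs
begin

text \<open>Exchanging \<open>s\<close> and \<open>s'\<close> swaps the two parities of the blocks \<open>F\<^sub>J\<close> and fixes every block \<open>G\<^sub>p\<close>
  except \<open>G\<^sub>r\<close>, where \<open>s = r + 1\<close>. It therefore induces an isomorphism of the contractions along
  \<open>I\<close> whenever \<open>I\<close> avoids \<open>s\<close> and \<open>s'\<close> and the contraction of \<open>G\<^sub>r \<union> {0}\<close> contains that of some other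
  block, so that \<open>G\<^sub>r\<close> does not matter for the minimal elements. Such an \<open>r\<close> exists for
  every two-element set \<open>I\<close> except \<open>{0, 0'}\<close>, whose contraction has a least element, and \<open>{p, p'}\<close>,
  along which the two systems have equal contractions.\<close>

section \<open>Contractions of set systems\<close>

lemma contraction_eq_image: "contraction A \<A> I = (\<lambda>S. S // theta A I) ` \<A>"
  by (auto simp: contraction_def)

text \<open>An element of \<open>S\<close> outside \<open>T\<close> lies in \<open>I\<close>, and
  \<open>T\<close> has an element of \<open>I\<close> with the same class.\<close>

lemma quotient_theta_subsetI:
  assumes "S \<subseteq> A" "T \<subseteq> A" and "\<And>x. x \<in> S \<Longrightarrow> x \<in> T \<or> x \<in> I \<and> T \<inter> I \<noteq> {}"
  shows "S // theta A I \<subseteq> T // theta A I"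
proof
  fix C assume "C \<in> S // theta A I"
  then obtain x where x: "x \<in> S" "C = theta A I `` {x}"
    by (auto simp: quotient_def)
  show "C \<in> T // theta A I"
  proof (cases "x \<in> T")
    case True
    then show ?thesis using x by (auto simp: quotient_def)
  next
    case False
    then obtain y where y: "x \<in> I" "y \<in> T" "y \<in> I"
      using assms(3) x(1) by blast
    then have "theta A I `` {x} = theta A I `` {y}"
      using assms(1,2) x(1) by (auto simp: theta_def)
    then show ?thesis using x(2) y(2) by (auto simp: quotient_def)
  qed
qed

text \<open>The image of \<open>D\<close> either coincides with that of \<open>B\<close> or lies
  strictly above it; in the second case it is not minimal, and whatever it would rule out is already
  ruled out by the image of \<open>B\<close>. This permits discarding the one block that a flip does
  not respect.\<close>

lemma minimal_contraction_remove:
  assumes "B \<in> \<A>" "B \<noteq> D" "B // theta A I \<subseteq> D // theta A I"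
  shows "minimal_contraction A (\<A> - {D}) I = minimal_contraction A \<A> I"
proof (cases "D \<in> \<A>")
  case True
  let ?q = "\<lambda>S. S // theta A I"
  have split: "contraction A \<A> I = insert (?q D) (contraction A (\<A> - {D}) I)"
    using True by (auto simp: contraction_eq_image)
  have B: "?q B \<in> contraction A (\<A> - {D}) I"
    using assms by (auto simp: contraction_eq_image)
  show ?thesis
  proof (cases "?q B = ?q D")
    case True
    then have "contraction A \<A> I = contraction A (\<A> - {D}) I"
      using split B by auto
    then show ?thesis by (simp add: minimal_contraction_def)
  next
    case False
    then have "?q B \<subset> ?q D" using assms(3) by auto
    then show ?thesis
      unfolding minimal_contraction_def split using B by blast
  qed
qed simp

lemma minimal_contraction_least:
  assumes "D \<in> \<A>" "\<And>B. B \<in> \<A> \<Longrightarrow> D // theta A I \<subseteq> B // theta A I"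
  shows "minimal_contraction A \<A> I = {D // theta A I}"
  using assms unfolding minimal_contraction_def contraction_eq_image by blast

lemma set_system_iso_refl: "set_system_iso A \<A> A \<A>"
  unfolding set_system_iso_def by (rule exI[of _ id]) auto

text \<open>By injectivity \<open>\<sigma>\<close> preserves membership in \<open>I\<close> as well
  as non-membership, and the classes are \<open>I\<close> and singletons.\<close>

lemma theta_class_image:
  assumes "bij_betw \<sigma> A A" "\<sigma> ` I = I" "I \<subseteq> A" "x \<in> A"
  shows "\<sigma> ` (theta A I `` {x}) = theta A I `` {\<sigma> x}"
proof -
  have inj: "inj_on \<sigma> A" and surj: "\<sigma> ` A = A"
    using assms(1) by (auto simp: bij_betw_def)
  have I: "\<sigma> y \<in> I \<longleftrightarrow> y \<in> I" if "y \<in> A" for y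
    using inj_on_image_mem_iff[OF inj that assms(3)] assms(2) by simp
  have cls: "theta A I `` {z} = (if z \<in> I then I else {z})" if "z \<in> A" for z
    using that assms(3) by (auto simp: theta_def)
  have "\<sigma> x \<in> A" using surj assms(4) by blast
  then show ?thesis using assms(2,4) I by (simp add: cls)
qed

lemma minimal_elements_image:
  assumes "\<And>T T'. T \<in> C \<Longrightarrow> T' \<in> C \<Longrightarrow> R' (g T') (g T) \<longleftrightarrow> R T' T"
  shows "{T \<in> g ` C. \<not> (\<exists>T'\<in>g ` C. R' T' T)} = g ` {T \<in> C. \<not> (\<exists>T'\<in>C. R T' T)}"
  using assms by auto

text \<open>Since \<open>\<sigma>\<close> permutes the classes of \<open>theta A I\<close>, its
  action on classes is the required bijection of the quotient. It preserves strict inclusion between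
  contracted blocks and hence minimality.\<close>

lemma set_system_iso_minimal_contraction:
  assumes "bij_betw \<sigma> A A" "\<sigma> ` I = I" "I \<subseteq> A" "\<A> \<subseteq> Pow A"
  shows "set_system_iso (A // theta A I) (minimal_contraction A \<A> I)
           (A // theta A I) (minimal_contraction A ((`) \<sigma> ` \<A>) I)"
proof -
  let ?q = "\<lambda>S. S // theta A I"
  have inj: "inj_on \<sigma> A" and surj: "\<sigma> ` A = A"
    using assms(1) by (auto simp: bij_betw_def)
  have q: "(`) \<sigma> ` ?q S = ?q (\<sigma> ` S)" if "S \<subseteq> A" for S
  proof -
    have "?q S = (\<lambda>x. theta A I `` {x}) ` S" for S
      by (auto simp: quotient_def)
    moreover have "\<sigma> ` (theta A I `` {x}) = theta A I `` {\<sigma> x}" if "x \<in> S" for x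
      using theta_class_image[OF assms(1-3)] that \<open>S \<subseteq> A\<close> by blast
    ultimately show ?thesis by (simp add: image_image)
  qed
  have qA: "?q A \<subseteq> Pow A" by (auto simp: quotient_def theta_def)
  have injq: "inj_on ((`) \<sigma>) (?q A)"
    using inj_on_image_Pow[OF inj] qA by (rule inj_on_subset)
  have bij: "bij_betw ((`) \<sigma>) (?q A) (?q A)"
    using injq q[of A] surj by (simp add: bij_betw_def)
  have sub: "contraction A \<A> I \<subseteq> Pow (?q A)"
    using assms(4) by (fastforce simp: contraction_eq_image quotient_def)
  have con: "contraction A ((`) \<sigma> ` \<A>) I = (`) ((`) \<sigma>) ` contraction A \<A> I"
    unfolding contraction_eq_image image_image
    by (rule image_cong[OF refl]) (use q assms(4) in auto)
  have less: "(`) \<sigma> ` T' \<subset> (`) \<sigma> ` T \<longleftrightarrow> T' \<subset> T"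
    if "T \<in> contraction A \<A> I" "T' \<in> contraction A \<A> I" for T T'
  proof -
    have "T \<subseteq> ?q A" "T' \<subseteq> ?q A" using that sub by auto
    \<comment> \<open>Inclusion is read as \<open>T \<union> T' = T\<close>, so that injectivity on
      the quotient reflects it.\<close>
    moreover from this have "(`) \<sigma> ` T' \<subseteq> (`) \<sigma> ` T \<longleftrightarrow> T' \<subseteq> T"
      using inj_on_image_eq_iff[OF injq, of "T \<union> T'" T] by (auto simp: image_Un)
    ultimately show ?thesis
      using inj_on_image_eq_iff[OF injq] by (simp add: psubset_eq)
  qed
  have "minimal_contraction A ((`) \<sigma> ` \<A>) I = (`) ((`) \<sigma>) ` minimal_contraction A \<A> I"
    unfolding minimal_contraction_def con
    by (rule minimal_elements_image[where R = "(\<subset>)" and R' = "(\<subset>)"]) (rule less)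
  then show ?thesis
    unfolding set_system_iso_def using bij by (intro exI[of _ "(`) \<sigma>"]) auto
qed

section \<open>The two systems and the flips\<close>

text \<open>The parity is a parameter, so that one argument serves both systems and a flip leads
  from \<open>b\<close> to \<open>\<not> b\<close>.\<close>

definition U_system :: "nat \<Rightarrow> bool \<Rightarrow> elt set set" where
  "U_system m b =
     (\<lambda>J. insert (Plain 0) (F_block m J)) ` {J. J \<subseteq> {1..m} \<and> odd (card J) = b} \<union>
     (\<lambda>p. insert (Plain 0) (G_block m p)) ` {1..m} \<union> {{Plain 0, Primed 0}}"

lemma U_system_cases:
  assumes "B \<in> U_system m b"
  obtains (F) J where "J \<subseteq> {1..m}" "odd (card J) = b" "B = insert (Plain 0) (F_block m J)"
  | (G) p where "p \<in> {1..m}" "B = insert (Plain 0) (G_block m p)"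
  | (zero) "B = {Plain 0, Primed 0}"
  using assms unfolding U_system_def by (elim UnE imageE CollectE conjE singletonE)

lemma augmented_blocks_eq:
  "{S \<union> {x} |S. S \<in> {f J |J. P J} \<union> {g p |p. p \<in> A}} =
     (\<lambda>J. insert x (f J)) ` {J. P J} \<union> (\<lambda>p. insert x (g p)) ` A"
  by blast

lemma U1_system_eq: "U1_system m = U_system m True"
  unfolding U1_system_def M1_system_def F1_system_def G_system_def U_system_def augmented_blocks_eq
  by simp

lemma U2_system_eq: "U2_system m = U_system m False"
  unfolding U2_system_def M2_system_def F2_system_def G_system_def U_system_def augmented_blocks_eq
  by simp

section \<open>Indices, flips and the cyclic successor\<close>

primrec index :: "elt \<Rightarrow> nat" where
  "index (Plain n) = n"
| "index (Primed n) = n"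

primrec flip :: "nat \<Rightarrow> elt \<Rightarrow> elt" where
  "flip s (Plain n) = (if n = s then Primed n else Plain n)"
| "flip s (Primed n) = (if n = s then Plain n else Primed n)"

text \<open>This is \<open>add_mod m p 1\<close> on \<open>{1..m}\<close>, with a case distinction
  in place of modular arithmetic.\<close>

definition cyc_suc :: "nat \<Rightarrow> nat \<Rightarrow> nat" where
  "cyc_suc m p = (if p = m then 1 else Suc p)"

lemma add_mod_1: "1 \<le> p \<Longrightarrow> p \<le> m \<Longrightarrow> add_mod m p (Suc 0) = cyc_suc m p"
  by (auto simp: add_mod_def cyc_suc_def)

lemma cyc_suc_bounds [simp]:
  "1 \<le> p \<Longrightarrow> p \<le> m \<Longrightarrow> Suc 0 \<le> cyc_suc m p" "1 \<le> p \<Longrightarrow> p \<le> m \<Longrightarrow> cyc_suc m p \<le> m"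
  by (auto simp: cyc_suc_def)

lemma cyc_suc_nonzero [simp]: "cyc_suc m p \<noteq> 0" "0 < cyc_suc m p"
  by (auto simp: cyc_suc_def)

lemma cyc_suc_in: "p \<in> {1..m} \<Longrightarrow> cyc_suc m p \<in> {1..m}"
  by simp

lemma cyc_suc_inject: "p \<in> {1..m} \<Longrightarrow> q \<in> {1..m} \<Longrightarrow> cyc_suc m p = cyc_suc m q \<longleftrightarrow> p = q"
  by (auto simp: cyc_suc_def split: if_splits)

text \<open>In a cycle of length at least 3 neither one step nor two steps return to the start. This
  keeps \<open>r\<close>, \<open>r + 1\<close> and \<open>r + 2\<close> distinct later on.\<close>

lemma cyc_suc_neq: "m \<ge> 3 \<Longrightarrow> cyc_suc m p \<noteq> p" "m \<ge> 3 \<Longrightarrow> cyc_suc m (cyc_suc m p) \<noteq> p"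
  by (auto simp: cyc_suc_def)

lemma Plain_in_F [simp]: "Plain n \<in> F_block m J \<longleftrightarrow> n \<in> J"
  by (auto simp: F_block_def)

lemma Primed_in_F [simp]: "Primed n \<in> F_block m J \<longleftrightarrow> n \<in> {1..m} \<and> n \<notin> J"
  by (auto simp: F_block_def)

lemma Plain_in_G [simp]: "Plain n \<in> G_block m p \<longleftrightarrow> n \<in> {1..m} \<and> n \<noteq> p"
  by (auto simp: G_block_def E_set_def)

lemma Primed_in_G [simp]:
  "p \<in> {1..m} \<Longrightarrow> Primed n \<in> G_block m p \<longleftrightarrow> n \<in> {1..m} \<and> n \<noteq> p \<and> n \<noteq> cyc_suc m p"
  by (auto simp: G_block_def E_set_def add_mod_1)

lemma in_U_ground_iff: "x \<in> U_ground m \<longleftrightarrow> index x \<le> m"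
  by (cases x) (auto simp: U_ground_def E_set_def image_iff)

lemma elt_set_eqI:
  "(\<And>n. Plain n \<in> A \<longleftrightarrow> Plain n \<in> B) \<Longrightarrow> (\<And>n. Primed n \<in> A \<longleftrightarrow> Primed n \<in> B) \<Longrightarrow> A = B"
  by (metis elt.exhaust subsetI subset_antisym)

lemma U_system_subset: "U_system m b \<subseteq> Pow (U_ground m)"
proof
  fix B assume "B \<in> U_system m b"
  then have "index x \<le> m" if "x \<in> B" for x
    using that by (cases x) (auto simp: U_system_def)
  then show "B \<in> Pow (U_ground m)"
    by (auto simp: in_U_ground_iff)
qed

lemma flip_flip [simp]: "flip s (flip s x) = x"
  by (cases x) auto

lemma in_flip_image: "x \<in> flip s ` S \<longleftrightarrow> flip s x \<in> S"
  by (auto intro: image_eqI[where x = "flip s x"])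

lemma index_flip [simp]: "index (flip s x) = index x"
  by (cases x) auto

lemma bij_betw_flip: "bij_betw (flip s) (U_ground m) (U_ground m)"
  by (rule bij_betw_byWitness[of _ "flip s"]) (auto simp: in_U_ground_iff)

text \<open>Symmetric difference with \<open>{s}\<close>, the effect on \<open>J\<close> of
  exchanging \<open>s\<close> and \<open>s'\<close> in \<open>F_block m J\<close>.\<close>

definition toggle :: "nat \<Rightarrow> nat set \<Rightarrow> nat set" where
  "toggle s J = (if s \<in> J then J - {s} else insert s J)"

lemma in_toggle: "n \<in> toggle s J \<longleftrightarrow> (n \<in> J) \<noteq> (n = s)"
  by (auto simp: toggle_def)

lemma even_card_toggle: "finite J \<Longrightarrow> even (card (toggle s J)) \<longleftrightarrow> odd (card J)"
  using card.remove[of J s] by (cases "s \<in> J") (simp_all add: toggle_def del: card_Diff_insert)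

lemma toggle_subset: "s \<in> {1..m} \<Longrightarrow> J \<subseteq> {1..m} \<Longrightarrow> toggle s J \<subseteq> {1..m}"
  by (auto simp: toggle_def)

lemma toggle_toggle: "toggle s (toggle s J) = J"
  by (auto simp: toggle_def)

lemma flip_F_block:
  assumes "s \<in> {1..m}"
  shows "flip s ` insert (Plain 0) (F_block m J) = insert (Plain 0) (F_block m (toggle s J))"
  using assms by (intro elt_set_eqI) (auto simp: in_flip_image in_toggle simp del: image_insert)

text \<open>The block has neither copy of \<open>p\<close> and both copies of every index of
  \<open>{1..m}\<close> other than \<open>p\<close> and \<open>p + 1\<close>; only at
  \<open>p + 1\<close> could the exchange change it.\<close>

lemma flip_G_block:
  assumes "s \<in> {1..m}" "p \<in> {1..m}" "cyc_suc m p \<noteq> s"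
  shows "flip s ` insert (Plain 0) (G_block m p) = insert (Plain 0) (G_block m p)"
  using assms by (intro elt_set_eqI) (auto simp: in_flip_image simp del: image_insert)

lemma toggle_family:
  assumes "s \<in> {1..m}"
  shows "toggle s ` {J. J \<subseteq> {1..m} \<and> odd (card J) = b} = {J. J \<subseteq> {1..m} \<and> odd (card J) = (\<not> b)}"
proof -
  have mem: "toggle s J \<in> {J. J \<subseteq> {1..m} \<and> odd (card J) = (\<not> b)}"
    if "J \<in> {J. J \<subseteq> {1..m} \<and> odd (card J) = b}" for J b
  proof -
    have J: "J \<subseteq> {1..m}" "odd (card J) = b" using that by blast+
    then have "finite J" by (simp add: finite_subset)
    then show ?thesis
      using toggle_subset[OF assms J(1)] even_card_toggle[of J s] J(2) by blast
  qed
  show ?thesis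
  proof (intro subset_antisym subsetI)
    fix J assume "J \<in> {J. J \<subseteq> {1..m} \<and> odd (card J) = (\<not> b)}"
    then show "J \<in> toggle s ` {J. J \<subseteq> {1..m} \<and> odd (card J) = b}"
      using mem[of J "\<not> b"] by (intro image_eqI[where x = "toggle s J"]) (simp_all only: toggle_toggle not_not)
  qed (elim imageE, simp only: mem)
qed

section \<open>Incomparability of the blocks\<close>

lemma G_block_inject:
  assumes "p \<in> {1..m}" "q \<in> {1..m}" "insert (Plain 0) (G_block m p) \<subseteq> insert (Plain 0) (G_block m q)"
  shows "p = q"
proof (rule ccontr)
  assume "p \<noteq> q"
  then have "Plain q \<in> insert (Plain 0) (G_block m p)" "Plain q \<notin> insert (Plain 0) (G_block m q)"
    using assms by auto
  with assms(3) show False by blast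
qed

text \<open>One of \<open>p\<close> and \<open>p'\<close> is in \<open>F_block m J\<close>, whereas
  \<open>G_block m p\<close> omits both.\<close>

lemma F_not_subset_G:
  assumes "p \<in> {1..m}"
  shows "\<not> insert (Plain 0) (F_block m J) \<subseteq> insert (Plain 0) (G_block m p)"
proof (cases "p \<in> J")
  case True
  then have "Plain p \<in> F_block m J" "Plain p \<notin> insert (Plain 0) (G_block m p)"
    using assms by auto
  then show ?thesis by blast
next
  case False
  then have "Primed p \<in> F_block m J" "Primed p \<notin> insert (Plain 0) (G_block m p)"
    using assms by auto
  then show ?thesis by blast
qed

text \<open>Both copies of \<open>p + 2\<close> lie in \<open>G_block m p\<close>, but no F-block
  has both copies of an index.\<close>

lemma G_not_subset_F:
  assumes "m \<ge> 3" "p \<in> {1..m}" "J \<subseteq> {1..m}"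
  shows "\<not> insert (Plain 0) (G_block m p) \<subseteq> insert (Plain 0) (F_block m J)"
proof -
  let ?q = "cyc_suc m (cyc_suc m p)"
  have "?q \<in> {1..m}" using assms by simp
  then have "Plain ?q \<in> G_block m p" "Primed ?q \<in> G_block m p" "?q \<noteq> 0"
    using assms cyc_suc_neq[of m p] cyc_suc_neq(1)[of m "cyc_suc m p"] by auto
  moreover have "Plain ?q \<notin> insert (Plain 0) (F_block m J) \<or> Primed ?q \<notin> insert (Plain 0) (F_block m J)"
    using \<open>?q \<noteq> 0\<close> by auto
  ultimately show ?thesis by blast
qed

lemma F_block_inject:
  assumes "J \<subseteq> {1..m}" "K \<subseteq> {1..m}" "insert (Plain 0) (F_block m J) \<subseteq> insert (Plain 0) (F_block m K)"
  shows "J = K"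
proof -
  have "n \<in> J \<longleftrightarrow> n \<in> K" if "n \<in> {1..m}" for n
    using subsetD[OF assms(3), of "Plain n"] subsetD[OF assms(3), of "Primed n"] that by auto
  then show ?thesis using assms(1,2) by blast
qed

lemma zero_block_not_comparable:
  assumes "m \<ge> 3"
  shows "\<not> {Plain 0, Primed 0} \<subseteq> insert (Plain 0) (F_block m J)"
    and "p \<in> {1..m} \<Longrightarrow> \<not> {Plain 0, Primed 0} \<subseteq> insert (Plain 0) (G_block m p)"
    and "\<not> insert (Plain 0) (F_block m J) \<subseteq> {Plain 0, Primed 0}"
    and "p \<in> {1..m} \<Longrightarrow> \<not> insert (Plain 0) (G_block m p) \<subseteq> {Plain 0, Primed 0}"
proof -
  show "\<not> {Plain 0, Primed 0} \<subseteq> insert (Plain 0) (F_block m J)"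
    and "p \<in> {1..m} \<Longrightarrow> \<not> {Plain 0, Primed 0} \<subseteq> insert (Plain 0) (G_block m p)"
    by auto
  have "Plain 1 \<in> F_block m J \<or> Primed 1 \<in> F_block m J"
    using assms by auto
  then show "\<not> insert (Plain 0) (F_block m J) \<subseteq> {Plain 0, Primed 0}"
    by (auto simp del: Plain_in_F Primed_in_F)
  assume "p \<in> {1..m}"
  \<comment> \<open>At \<open>p + 1\<close> only the primed copy is removed, so the plain one
    witnesses an element of nonzero index.\<close>
  then have "Plain (cyc_suc m p) \<in> G_block m p" "cyc_suc m p \<noteq> 0"
    using cyc_suc_in[of p m] cyc_suc_neq(1)[OF assms, of p] by auto
  then show "\<not> insert (Plain 0) (G_block m p) \<subseteq> {Plain 0, Primed 0}"
    by (auto dest!: subsetD simp del: Plain_in_G)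
qed

lemma sperner_system_U:
  assumes "m \<ge> 3"
  shows "sperner_system (U_ground m) (U_system m b)"
proof -
  have "finite (U_ground m)" by (simp add: U_ground_def E_set_def)
  moreover have "S = T" if "S \<in> U_system m b" "T \<in> U_system m b" "S \<subseteq> T" for S T
    using that(1)
  proof (cases rule: U_system_cases)
    case (F J)
    show ?thesis using that(2)
    proof (cases rule: U_system_cases)
      case (F K)
      then show ?thesis using F_block_inject[of J m K] \<open>S = _\<close> \<open>J \<subseteq> _\<close> that(3) by simp
    next
      case (G q)
      then show ?thesis using F_not_subset_G[OF G(1)] F(3) that(3) by simp
    next
      case zero
      then show ?thesis using zero_block_not_comparable(3)[OF assms] F(3) that(3) by blast
    qed
  next
    case (G p)
    show ?thesis using that(2)
    proof (cases rule: U_system_cases)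
      case (F K)
      then show ?thesis using G_not_subset_F[OF assms G(1) F(1)] G(2) that(3) by simp
    next
      case (G q)
      then show ?thesis using G_block_inject[of p m q] \<open>S = _\<close> \<open>p \<in> _\<close> that(3) by simp
    next
      case zero
      then show ?thesis using zero_block_not_comparable(4)[OF assms G(1)] G(2) that(3) by blast
    qed
  next
    case zero
    show ?thesis using that(2)
    proof (cases rule: U_system_cases)
      case (F K)
      then show ?thesis using zero_block_not_comparable(1)[OF assms] zero that(3) by blast
    next
      case (G q)
      then show ?thesis using zero_block_not_comparable(2)[OF assms G(1)] zero that(3) by blast
    qed (simp add: zero)
  qed
  ultimately show ?thesis
    using U_system_subset by (simp add: sperner_system_def set_system_def)
qed

section \<open>Isomorphisms of the contractions\<close>

text \<open>The flip at \<open>r + 1\<close> exchanges the parities of the F-blocks and fixes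
  \<open>{0, 0'}\<close>. As the cyclic successor is injective, \<open>r\<close> is the only
  \<open>p\<close> with \<open>p + 1 = r + 1\<close>, so all G-blocks except \<open>D\<close> are
  fixed too.\<close>

lemma flip_U_system:
  assumes "m \<ge> 3" "r \<in> {1..m}"
  defines "D \<equiv> insert (Plain 0) (G_block m r)"
  shows "(`) (flip (cyc_suc m r)) ` (U_system m b - {D}) = U_system m (\<not> b) - {D}"
proof -
  let ?s = "cyc_suc m r"
  let ?F = "\<lambda>J. insert (Plain 0) (F_block m J)" and ?G = "\<lambda>p. insert (Plain 0) (G_block m p)"
  let ?P = "\<lambda>b. {J. J \<subseteq> {1..m} \<and> odd (card J) = b}"
  have s: "?s \<in> {1..m}" using assms by simp
  have split: "U_system m b - {D} = ?F ` ?P b \<union> ?G ` ({1..m} - {r}) \<union> {{Plain 0, Primed 0}}" for b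
  proof -
    have "?F J \<noteq> D" for J using F_not_subset_G[OF assms(2)] by (auto simp: D_def)
    then have F: "?F ` ?P b - {D} = ?F ` ?P b" by blast
    have "?G p \<noteq> D" if "p \<in> {1..m} - {r}" for p
      using G_block_inject[of p m r] that assms(2) by (auto simp: D_def)
    moreover have "?G r = D" by (simp add: D_def)
    ultimately have G: "?G ` {1..m} - {D} = ?G ` ({1..m} - {r})" by blast
    have "{Plain 0, Primed 0} \<noteq> D"
      using zero_block_not_comparable(2)[OF assms(1,2)] by (auto simp: D_def)
    then have Z: "{{Plain 0, Primed 0}} - {D} = {{Plain 0, Primed 0}}" by simp
    show ?thesis unfolding U_system_def Un_Diff F G Z ..
  qed
  have "(`) (flip ?s) ` ?F ` ?P b = ?F ` toggle ?s ` ?P b"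
    unfolding image_image using flip_F_block[OF s] by (intro image_cong) auto
  then have "(`) (flip ?s) ` ?F ` ?P b = ?F ` ?P (\<not> b)"
    by (simp only: toggle_family[OF s])
  moreover have "(`) (flip ?s) ` ?G ` ({1..m} - {r}) = ?G ` ({1..m} - {r})"
    unfolding image_image
    by (rule image_cong[OF refl], rule flip_G_block[OF s]) (use assms cyc_suc_inject in auto)
  moreover have "(`) (flip ?s) ` {{Plain 0, Primed 0}} = {{Plain 0, Primed 0}}"
    using s by auto
  ultimately show ?thesis unfolding split image_Un by (simp only:)
qed

text \<open>\<open>cover\<close> supplies a block whose contraction lies below that of
  \<open>G_block m r\<close> with \<open>0\<close> added; it is required for both parities because
  this block is discarded from both systems. \<open>avoid\<close> makes the flip fix
  \<open>I\<close> pointwise.\<close>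

lemma iso_via_flip:
  assumes "m \<ge> 3" "r \<in> {1..m}" "I \<subseteq> U_ground m"
    and avoid: "\<And>x. x \<in> I \<Longrightarrow> index x \<noteq> cyc_suc m r"
    and cover: "\<And>b. \<exists>B \<in> U_system m b. B \<noteq> insert (Plain 0) (G_block m r) \<and>
      (\<forall>x\<in>B. x \<in> insert (Plain 0) (G_block m r) \<or> x \<in> I \<and> insert (Plain 0) (G_block m r) \<inter> I \<noteq> {})"
  shows "set_system_iso (U_ground m // theta (U_ground m) I)
           (minimal_contraction (U_ground m) (U_system m b) I)
           (U_ground m // theta (U_ground m) I)
           (minimal_contraction (U_ground m) (U_system m (\<not> b)) I)"
proof -
  let ?D = "insert (Plain 0) (G_block m r)"
  have D: "?D \<subseteq> U_ground m"
  proof -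
    have "?D \<in> U_system m True" using assms(2) by (auto simp: U_system_def)
    then show ?thesis using U_system_subset by blast
  qed
  have rem: "minimal_contraction (U_ground m) (U_system m b - {?D}) I
      = minimal_contraction (U_ground m) (U_system m b) I" for b
  proof -
    from cover[of b] obtain B where B: "B \<in> U_system m b" "B \<noteq> ?D"
      and sub: "\<forall>x\<in>B. x \<in> ?D \<or> x \<in> I \<and> ?D \<inter> I \<noteq> {}"
      by (elim bexE conjE) (rule that)
    have "B \<subseteq> U_ground m" using B(1) U_system_subset by blast
    then have "B // theta (U_ground m) I \<subseteq> ?D // theta (U_ground m) I"
      using D bspec[OF sub] by (rule quotient_theta_subsetI)
    with B show ?thesis by (rule minimal_contraction_remove)
  qed
  have "flip (cyc_suc m r) x = x" if "x \<in> I" for x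
    using avoid[OF that] by (cases x) simp_all
  then have "flip (cyc_suc m r) ` I = I" by simp
  moreover have "U_system m b - {?D} \<subseteq> Pow (U_ground m)"
    using U_system_subset by blast
  ultimately show ?thesis
    using set_system_iso_minimal_contraction[OF bij_betw_flip _ assms(3), of "cyc_suc m r" "U_system m b - {?D}"]
    unfolding flip_U_system[OF assms(1,2)] rem by (simp only: simp_thms)
qed

text \<open>Let \<open>r\<close> be the index of \<open>x\<close> and \<open>s = r + 1\<close>. A block \<open>F\<^sub>J\<close> with \<open>s \<in> J\<close> fits into
  \<open>G\<^sub>r\<close> up to the element \<open>r\<close> or \<open>r'\<close>, which is identified with
  \<open>y \<in> G\<^sub>r \<union> {0}\<close>; toggling the index \<open>s + 1\<close> adjusts the parity of \<open>J\<close>.\<close>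

lemma iso_via_F_block:
  assumes "m \<ge> 3" "index x \<in> {1..m}" "y \<in> U_ground m" "y \<noteq> Primed 0"
    and "index y \<noteq> index x" "index y \<noteq> cyc_suc m (index x)"
  shows "set_system_iso (U_ground m // theta (U_ground m) {x, y})
           (minimal_contraction (U_ground m) (U_system m b) {x, y})
           (U_ground m // theta (U_ground m) {x, y})
           (minimal_contraction (U_ground m) (U_system m (\<not> b)) {x, y})"
proof (rule iso_via_flip[OF assms(1,2)])
  let ?r = "index x"
  let ?s = "cyc_suc m ?r"
  let ?q = "cyc_suc m ?s"
  have neq: "?s \<noteq> ?r" "?q \<noteq> ?r" "?q \<noteq> ?s"
    using cyc_suc_neq[OF assms(1)] by auto
  have s: "?s \<in> {1..m}" and q: "?q \<in> {1..m}" using assms(2) by auto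
  show "{x, y} \<subseteq> U_ground m" using assms by (simp add: in_U_ground_iff)
  show "index z \<noteq> ?s" if "z \<in> {x, y}" for z
    using that assms(6) neq(1) by auto
  fix b
  let ?D = "insert (Plain 0) (G_block m ?r)"
  \<comment> \<open>If \<open>y\<close> has index 0 it is \<open>Plain 0\<close>; otherwise its
    index differs from \<open>r\<close> and \<open>r + 1\<close>, the only indices in
    \<open>{1..m}\<close> at which \<open>?D\<close> lacks an element.\<close>
  have y: "y \<in> ?D"
    using assms(2-6) by (cases y) (auto simp: in_U_ground_iff)
  \<comment> \<open>Membership of \<open>r\<close> is chosen so that \<open>x\<close> is the only
    element of index \<open>r\<close> in the F-block; membership of \<open>s\<close> keeps out
    \<open>s'\<close>, the other element missing from \<open>?D\<close>.\<close>
  define J0 where "J0 = (if x = Plain ?r then {?r, ?s} else {?s})"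
  \<comment> \<open>As \<open>?q\<close> differs from \<open>r\<close> and \<open>s\<close>,
    correcting the parity there disturbs neither choice.\<close>
  define J where "J = (if odd (card J0) = b then J0 else toggle ?q J0)"
  have J0: "J0 \<subseteq> {1..m}" using assms(2) s by (auto simp: J0_def)
  have J: "J \<subseteq> {1..m}" "odd (card J) = b"
    using J0 toggle_subset[OF q J0] even_card_toggle[OF finite_subset[OF J0], of ?q] by (auto simp: J_def)
  have Js: "?s \<in> J" "?r \<in> J \<longleftrightarrow> x = Plain ?r"
    using neq by (auto simp: J_def J0_def in_toggle)
  have fit: "z \<in> ?D \<or> z \<in> {x, y} \<and> ?D \<inter> {x, y} \<noteq> {}"
    if z: "z \<in> insert (Plain 0) (F_block m J)" for z
  proof (cases "index z = ?r")
    case True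
    then have "z = x" using z Js(2) assms(2) by (cases x; cases z) auto
    then show ?thesis using y by blast
  next
    case False
    then have "z \<in> ?D" using z Js(1) J(1) assms(2) by (cases z) auto
    then show ?thesis by blast
  qed
  show "\<exists>B \<in> U_system m b. B \<noteq> ?D \<and> (\<forall>z\<in>B. z \<in> ?D \<or> z \<in> {x, y} \<and> ?D \<inter> {x, y} \<noteq> {})"
  proof (intro bexI conjI ballI)
    show "insert (Plain 0) (F_block m J) \<noteq> ?D"
      using F_not_subset_G[OF assms(2)] by blast
    show "insert (Plain 0) (F_block m J) \<in> U_system m b"
      using J by (auto simp: U_system_def)
  qed (rule fit)
qed

text \<open>With \<open>r\<close> the successor of the index of \<open>x\<close>, that index is
  neither \<open>r\<close> nor \<open>r + 1\<close>, so \<open>G_block m r\<close> contains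
  \<open>x\<close>. Once \<open>0'\<close> is identified with \<open>x\<close>, the block
  \<open>{0, 0'}\<close> fits below it.\<close>

lemma iso_via_zero_block:
  assumes "m \<ge> 3" "index x \<in> {1..m}"
  shows "set_system_iso (U_ground m // theta (U_ground m) {x, Primed 0})
           (minimal_contraction (U_ground m) (U_system m b) {x, Primed 0})
           (U_ground m // theta (U_ground m) {x, Primed 0})
           (minimal_contraction (U_ground m) (U_system m (\<not> b)) {x, Primed 0})"
proof (rule iso_via_flip[OF assms(1)])
  let ?r = "cyc_suc m (index x)"
  show r: "?r \<in> {1..m}" using assms by simp
  show "{x, Primed 0} \<subseteq> U_ground m" using assms by (simp add: in_U_ground_iff)
  show "index z \<noteq> cyc_suc m ?r" if "z \<in> {x, Primed 0}" for z
    using that cyc_suc_neq(2)[OF assms(1), of "index x"] cyc_suc_in[OF r] by auto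
  fix b
  have "x \<in> G_block m ?r"
    using cyc_suc_neq[OF assms(1), of "index x", symmetric] assms(2) r
    by (cases x) simp_all
  then show "\<exists>B \<in> U_system m b. B \<noteq> insert (Plain 0) (G_block m ?r) \<and>
      (\<forall>z\<in>B. z \<in> insert (Plain 0) (G_block m ?r) \<or>
        z \<in> {x, Primed 0} \<and> insert (Plain 0) (G_block m ?r) \<inter> {x, Primed 0} \<noteq> {})"
    using zero_block_not_comparable(2)[OF assms(1) r]
    by (intro bexI[of _ "{Plain 0, Primed 0}"]) (auto simp: U_system_def)
qed

lemma iso_distinct_index:
  assumes "m \<ge> 3" "x \<in> U_ground m" "y \<in> U_ground m" "index x \<noteq> index y"
  shows "set_system_iso (U_ground m // theta (U_ground m) {x, y})
           (minimal_contraction (U_ground m) (U_system m b) {x, y})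
           (U_ground m // theta (U_ground m) {x, y})
           (minimal_contraction (U_ground m) (U_system m (\<not> b)) {x, y})"
    (is "?iso x y")
proof -
  have *: "?iso x y"
    if "x \<in> U_ground m" "y \<in> U_ground m" "index x \<noteq> index y"
      "index x \<noteq> 0" "index y \<noteq> cyc_suc m (index x)" for x y
  proof -
    have x: "index x \<in> {1..m}" using that by (simp add: in_U_ground_iff)
    show ?thesis
    proof (cases "y = Primed 0")
      case True
      then show ?thesis using iso_via_zero_block[OF assms(1) x] by simp
    next
      case False
      then show ?thesis
        using that by (intro iso_via_F_block[OF assms(1) x]) simp_all
    qed
  qed
  \<comment> \<open>One of the two orders of the pair always suits \<open>*\<close>: if
    \<open>x\<close> has index 0, it is no cyclic successor; if \<open>y\<close> has the successor
    index of \<open>x\<close>, a second step does not lead back to \<open>x\<close>.\<close>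
  have "index x \<noteq> 0 \<and> index y \<noteq> cyc_suc m (index x) \<or> index y \<noteq> 0 \<and> index x \<noteq> cyc_suc m (index y)"
    using cyc_suc_neq(2)[OF assms(1), of "index x"] assms(4) cyc_suc_nonzero(1) by metis
  then show ?thesis
  proof (elim disjE conjE)
    assume "index y \<noteq> 0" "index x \<noteq> cyc_suc m (index y)"
    then show ?thesis
      unfolding insert_commute[of x y "{}"] using assms(2-4) by (intro *) simp_all
  qed (intro * assms)
qed

text \<open>Every block contains \<open>0\<close>, so its contraction contains the class
  \<open>{0, 0'}\<close>, the only class in the contraction of the block
  \<open>{0, 0'}\<close>.\<close>

lemma minimal_contraction_zero_pair:
  "minimal_contraction (U_ground m) (U_system m b) {Plain 0, Primed 0}
    = {{Plain 0, Primed 0} // theta (U_ground m) {Plain 0, Primed 0}}"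
proof (rule minimal_contraction_least)
  show "{Plain 0, Primed 0} \<in> U_system m b" by (simp add: U_system_def)
  fix B assume B: "B \<in> U_system m b"
  then have "Plain 0 \<in> B" by (auto simp: U_system_def)
  moreover have "B \<subseteq> U_ground m" using B U_system_subset by blast
  ultimately show "{Plain 0, Primed 0} // theta (U_ground m) {Plain 0, Primed 0}
      \<subseteq> B // theta (U_ground m) {Plain 0, Primed 0}"
    by (intro quotient_theta_subsetI) (auto simp: in_U_ground_iff)
qed

text \<open>Toggling \<open>p\<close> replaces one of \<open>p\<close>, \<open>p'\<close> by the
  other in an F-block, which the identification makes invisible, and it changes the parity. All
  other blocks are common to both systems.\<close>

lemma contraction_twin_pair:
  assumes "p \<in> {1..m}"
  shows "contraction (U_ground m) (U_system m b) {Plain p, Primed p}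
    = contraction (U_ground m) (U_system m c) {Plain p, Primed p}"
proof -
  let ?q = "\<lambda>S. S // theta (U_ground m) {Plain p, Primed p}"
  let ?F = "\<lambda>J. insert (Plain 0) (F_block m J)"
  have blocks: "?F J \<in> U_system m b" if "J \<subseteq> {1..m}" "odd (card J) = b" for J b
    using that by (auto simp: U_system_def)
  have le: "?q (?F J) \<subseteq> ?q (?F (toggle p J))" if "J \<subseteq> {1..m}" for J
  proof (rule quotient_theta_subsetI)
    have "?F J \<subseteq> U_ground m" if "J \<subseteq> {1..m}" for J
      using blocks[OF that refl] U_system_subset by blast
    then show "?F J \<subseteq> U_ground m" "?F (toggle p J) \<subseteq> U_ground m"
      using that toggle_subset[OF assms that] by simp_all
    fix x assume x: "x \<in> ?F J"
    show "x \<in> ?F (toggle p J) \<or> x \<in> {Plain p, Primed p} \<and> ?F (toggle p J) \<inter> {Plain p, Primed p} \<noteq> {}"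
      using x assms by (cases x) (auto simp: in_toggle)
  qed
  \<comment> \<open>Since \<open>toggle p\<close> is an involution, \<open>le\<close> for the
    toggled set is the reverse inclusion.\<close>
  have eq: "?q (?F J) = ?q (?F (toggle p J))" if "J \<subseteq> {1..m}" for J
    using le[OF that] le[OF toggle_subset[OF assms that]] by (simp add: toggle_toggle)
  have "contraction (U_ground m) (U_system m b) {Plain p, Primed p}
    \<subseteq> contraction (U_ground m) (U_system m c) {Plain p, Primed p}" for b c
    unfolding contraction_eq_image
  proof (rule image_subsetI)
    fix B assume B: "B \<in> U_system m b"
    show "?q B \<in> ?q ` U_system m c"
      using B
    proof (cases rule: U_system_cases)
      case (F J)
      show ?thesis
      proof (cases "b = c")
        case False
        have "finite J" using \<open>J \<subseteq> {1..m}\<close> by (simp add: finite_subset)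
        then have "odd (card (toggle p J)) = c"
          using even_card_toggle[of J p] \<open>odd (card J) = b\<close> False by blast
        then have "?F (toggle p J) \<in> U_system m c"
          using blocks toggle_subset[OF assms \<open>J \<subseteq> {1..m}\<close>] by blast
        then show ?thesis using eq[OF \<open>J \<subseteq> {1..m}\<close>] \<open>B = ?F J\<close> by blast
      qed (use B in blast)
    qed (auto simp: U_system_def)
  qed
  then show ?thesis by blast
qed

theorem proposition3p20:
  fixes m :: nat
  assumes "m \<ge> 3"
  shows "strongly_hypomorphic (U_ground m) (U1_system m) (U2_system m)"
proof -
  have "set_system_iso (U_ground m // theta (U_ground m) I)
      (minimal_contraction (U_ground m) (U_system m True) I)
      (U_ground m // theta (U_ground m) I)
      (minimal_contraction (U_ground m) (U_system m False) I)"
    if I: "I \<subseteq> U_ground m" "card I = 2" for I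
  proof -
    obtain x y where xy: "I = {x, y}" "x \<noteq> y"
      using I(2) by (auto simp: card_2_iff)
    show ?thesis
    \<comment> \<open>Pairs with different indices admit a suitable flip; equal indices leave only
      the pairs \<open>n\<close>, \<open>n'\<close>, with \<open>n = 0\<close> treated
      separately.\<close>
    proof (cases "index x = index y")
      case False
      then show ?thesis using iso_distinct_index[OF assms, of x y True] I(1) xy(1) by simp
    next
      case True
      then have twin: "I = {Plain (index x), Primed (index x)}"
        using xy by (cases x; cases y) auto
      show ?thesis
      proof (cases "index x = 0")
        case True
        then show ?thesis
          using twin by (simp add: minimal_contraction_zero_pair set_system_iso_refl)
      next
        case False
        then have "index x \<in> {1..m}" using I(1) xy(1) by (simp add: in_U_ground_iff)
        from contraction_twin_pair[OF this, of True False] show ?thesis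
          using twin by (simp add: minimal_contraction_def set_system_iso_refl)
      qed
    qed
  qed
  then show ?thesis
    using sperner_system_U[OF assms]
    by (simp add: strongly_hypomorphic_def U1_system_eq U2_system_eq)
qed

end
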